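(* Let $M$ be an $n$-dimensional complex manifold. For any holomorphic vector bundle $V$ on $M$, any $\omega\otimes s\in A^{n,*}(V)$ (where $\omega\in A^{n,*}(M)$ and $s$ is a smooth section of $V$) and any $\phi_1,\phi_2\in A^{0,1}(M,T^{1,0}_M)$, there holds $$[\phi_1,\phi_2]\lrcorner(\omega\otimes s)=\big(\phi_1\lrcorner\partial(\phi_2\lrcorner\omega)\big)\otimes s-\partial\big(\phi_2\lrcorner(\phi_1\lrcorner\omega)\big)\otimes s+\big(\phi_2\lrcorner\partial(\phi_1\lrcorner\omega)\big)\otimes s,$$ or equivalently, $$[\phi_1,\phi_2]\lrcorner\omega=\phi_1\lrcorner\partial(\phi_2\lrcorner\omega)-\partial\big(\phi_2\lrcorner(\phi_1\lrcorner\omega)\big)+\phi_2\lrcorner\partial(\phi_1\lrcorner\omega).$$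
   Context: $A^{p,q}(M)$ is the space of smooth $(p,q)$-forms on $M$; $A^{p,q}(V)=A^{p,q}(M,V)$ is the space of smooth $(p,q)$-forms with coefficients in $V$; $A^{n,*}$ means bidegree $(n,q)$ with $q$ arbitrary. In local holomorphic coordinates $z^1,\dots,z^n$ write $\partial_i=\partial/\partial z^i$. Bracket: for $\varphi=\sum_i\varphi^i\otimes\partial_i$ and $\psi=\sum_i\psi^i\otimes\partial_i$ in $A^{0,1}(M,T^{1,0}_M)$ (so $\varphi^i,\psi^i$ are local $(0,1)$-forms), $$[\varphi,\psi]=\sum_{i,j=1}^n\big(\varphi^i\wedge\partial_i\psi^j+\psi^i\wedge\partial_i\varphi^j\big)\otimes\partial_j\in A^{0,2}(M,T^{1,0}_M),$$ where $\partial_i\varphi^j$ is obtained by applying $\partial_i$ to the coefficients of $\varphi^j$ with respect to $d\bar z^1,\dots,d\bar z^n$. Contraction: for $\varphi=\sum_i\varphi^i\otimes\partial_i\in A^{0,q}(M,T^{1,0}_M)$ and a form $\omega$, $\varphi\lrcorner\omega=\sum_i\varphi^i\wedge(\partial_i\lrcorner\omega)$, and $\varphi\lrcorner(\omega\otimes s)=(\varphi\lrcorner\omega)\otimes s$. *)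

theory Defs
  imports "HOL-Analysis.Analysis"
begin

section \<open>Functions on open subsets of complex coordinate space\<close>

text \<open>Derivatives are those over the reals; \<open>S\<close> is open in all uses.\<close>

primrec diff_order :: "nat \<Rightarrow> (complex^'n) set \<Rightarrow> (complex^'n \<Rightarrow> complex) \<Rightarrow> bool" where
  "diff_order 0 S f \<longleftrightarrow> continuous_on S f"
| "diff_order (Suc k) S f \<longleftrightarrow>
     (\<forall>z\<in>S. f differentiable (at z)) \<and>
     (\<forall>v. diff_order k S (\<lambda>z. frechet_derivative f (at z) v))"

definition smooth_fun :: "(complex^'n) set \<Rightarrow> (complex^'n \<Rightarrow> complex) \<Rightarrow> bool" where
  "smooth_fun S f \<longleftrightarrow> (\<forall>k. diff_order k S f)"

definition holomorphic_fun :: "(complex^'n) set \<Rightarrow> (complex^'n \<Rightarrow> complex) \<Rightarrow> bool" where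
  "holomorphic_fun S f \<longleftrightarrow>
     (\<forall>z\<in>S. \<exists>f'. (f has_derivative f') (at z) \<and> (\<forall>a v. f' (a *s v) = a * f' v))"

text \<open>The Wirtinger derivative: with \<open>z\<^sup>i = x\<^sup>i + \<i> y\<^sup>i\<close>, half of
  (the derivative along \<open>x\<^sup>i\<close> minus \<open>\<i>\<close> times the derivative along \<open>y\<^sup>i\<close>).\<close>

definition wirtinger :: "'n \<Rightarrow> (complex^'n \<Rightarrow> complex) \<Rightarrow> complex^'n \<Rightarrow> complex" where
  "wirtinger i f z =
     (frechet_derivative f (at z) (axis i 1) - \<i> * frechet_derivative f (at z) (axis i \<i>)) / 2"

definition jacobian :: "(complex^'n \<Rightarrow> complex^'n) \<Rightarrow> complex^'n \<Rightarrow> complex^'n^'n" where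
  "jacobian g z = (\<chi> i j. wirtinger j (\<lambda>w. g w $ i) z)"

section \<open>The exterior algebra of the complexified cotangent space\<close>

text \<open>The coframe is \<open>Dz i\<close>, \<open>Dzb i\<close> (the differential of \<open>z\<^sup>i\<close> and its conjugate),
  all \<open>Dz\<close> preceding all \<open>Dzb\<close>.\<close>

datatype 'n covec = Dz 'n | Dzb 'n

instance covec :: (finite) finite
proof
  have "(UNIV :: 'a covec set) = range Dz \<union> range Dzb"
    by (metis UNIV_eq_I Un_iff covec.exhaust rangeI)
  then show "finite (UNIV :: 'a covec set)"
    by (metis finite_UnI finite_imageI finite)
qed

instantiation covec :: (linorder) linorder
begin

fun less_eq_covec :: "'a covec \<Rightarrow> 'a covec \<Rightarrow> bool" where
  "less_eq_covec (Dz i) (Dz j) \<longleftrightarrow> i \<le> j"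
| "less_eq_covec (Dz i) (Dzb j) \<longleftrightarrow> True"
| "less_eq_covec (Dzb i) (Dz j) \<longleftrightarrow> False"
| "less_eq_covec (Dzb i) (Dzb j) \<longleftrightarrow> i \<le> j"

definition less_covec :: "'a covec \<Rightarrow> 'a covec \<Rightarrow> bool" where
  "less_covec a b \<longleftrightarrow> a \<le> b \<and> \<not> b \<le> a"

instance
proof
  fix x y z :: "'a covec"
  show "x < y \<longleftrightarrow> x \<le> y \<and> \<not> y \<le> x" by (rule less_covec_def)
  show "x \<le> x" by (cases x) auto
  show "x \<le> z" if "x \<le> y" "y \<le> z" using that by (cases x; cases y; cases z) auto
  show "x = y" if "x \<le> y" "y \<le> x" using that by (cases x; cases y) auto
  show "x \<le> y \<or> y \<le> x" by (cases x; cases y) auto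
qed

end

text \<open>The entry at \<open>K\<close> is the coefficient of the wedge product of the elements of \<open>K\<close>
  taken in increasing order.\<close>

type_synonym 'n ext = "complex^('n covec set)"
type_synonym 'n ext_tuple = "'n ext^'n"
type_synonym 'n square = "complex^'n^'n"

definition wedge :: "'n::{finite,linorder} ext \<Rightarrow> 'n ext \<Rightarrow> 'n ext" where
  "wedge \<alpha> \<beta> = (\<chi> K. \<Sum>I\<in>Pow K.
     (-1) ^ card {(a, b). a \<in> I \<and> b \<in> K - I \<and> b < a} * \<alpha> $ I * \<beta> $ (K - I))"

definition gen :: "'n::finite covec \<Rightarrow> 'n ext" where
  "gen a = axis {a} 1"

text \<open>Interior product with the frame vector dual to \<open>a\<close>; for \<open>a = Dz i\<close> this is
  contraction with \<open>\<partial>\<^sub>i\<close> into the first slot.\<close>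

definition interior_prod :: "'n::{finite,linorder} covec \<Rightarrow> 'n ext \<Rightarrow> 'n ext" where
  "interior_prod a \<alpha> =
     (\<chi> K. if a \<in> K then 0 else (-1) ^ card {b\<in>K. b < a} * \<alpha> $ insert a K)"

definition of_bidegree :: "nat \<Rightarrow> nat \<Rightarrow> 'n::finite ext \<Rightarrow> bool" where
  "of_bidegree p q \<alpha> \<longleftrightarrow>
     (\<forall>K. \<alpha> $ K \<noteq> 0 \<longrightarrow> card {i. Dz i \<in> K} = p \<and> card {i. Dzb i \<in> K} = q)"

text \<open>Pullback under a complex linear map with matrix \<open>J\<close>.\<close>

fun pullback_gen :: "'n square \<Rightarrow> 'n::finite covec \<Rightarrow> 'n ext" where
  "pullback_gen J (Dz i) = (\<Sum>j\<in>UNIV. J $ i $ j *s gen (Dz j))"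
| "pullback_gen J (Dzb i) = (\<Sum>j\<in>UNIV. cnj (J $ i $ j) *s gen (Dzb j))"

definition pullback :: "'n square \<Rightarrow> 'n::{finite,linorder} ext \<Rightarrow> 'n ext" where
  "pullback J \<alpha> =
     (\<Sum>K\<in>UNIV. \<alpha> $ K *s foldr wedge (map (pullback_gen J) (sorted_list_of_set K)) (axis {} 1))"

section \<open>Complex manifolds\<close>

type_synonym ('a, 'n) chart = "'a set \<times> ('a \<Rightarrow> complex^'n)"

definition coord :: "('a, 'n::finite) chart \<Rightarrow> 'a \<Rightarrow> complex^'n" where
  "coord c = snd c"

definition point :: "('a, 'n::finite) chart \<Rightarrow> complex^'n \<Rightarrow> 'a" where
  "point c = inv_into (fst c) (snd c)"

definition transition :: "('a, 'n::finite) chart \<Rightarrow> ('a, 'n) chart \<Rightarrow> complex^'n \<Rightarrow> complex^'n" where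
  "transition c c' z = coord c' (point c z)"

definition complex_manifold :: "'a topology \<Rightarrow> ('a, 'n::finite) chart set \<Rightarrow> bool" where
  "complex_manifold X A \<longleftrightarrow>
     Hausdorff_space X \<and> second_countable X \<and>
     (\<Union>c\<in>A. fst c) = topspace X \<and>
     (\<forall>c\<in>A. openin X (fst c) \<and> open (coord c ` fst c) \<and>
        homeomorphic_map (subtopology X (fst c)) (top_of_set (coord c ` fst c)) (coord c)) \<and>
     (\<forall>c\<in>A. \<forall>c'\<in>A. \<forall>i.
        holomorphic_fun (coord c ` (fst c \<inter> fst c')) (\<lambda>z. transition c c' z $ i))"

section \<open>Differential forms\<close>

text \<open>A form assigns to every chart its coordinate expression, a function of the coordinates.
  A form with values in the holomorphic tangent bundle has, in each chart, one component
  for every \<open>\<partial>\<^sub>i\<close>. Only values at points of the coordinate domain are meaningful.\<close>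

type_synonym ('a, 'n) form = "('a, 'n) chart \<Rightarrow> complex^'n \<Rightarrow> 'n ext"
type_synonym ('a, 'n) tform = "('a, 'n) chart \<Rightarrow> complex^'n \<Rightarrow> 'n ext_tuple"

definition smooth_forms ::
    "nat \<Rightarrow> nat \<Rightarrow> ('a, 'n::{finite,linorder}) chart set \<Rightarrow> ('a, 'n) form set" where
  "smooth_forms p q A = {\<omega>. \<forall>c\<in>A.
     (\<forall>K. smooth_fun (coord c ` fst c) (\<lambda>z. \<omega> c z $ K)) \<and>
     (\<forall>z\<in>coord c ` fst c. of_bidegree p q (\<omega> c z)) \<and>
     (\<forall>c'\<in>A. \<forall>z\<in>coord c ` (fst c \<inter> fst c').
        \<omega> c z = pullback (jacobian (transition c c') z) (\<omega> c' (transition c c' z)))}"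

text \<open>The last condition expresses that the sum of \<open>\<phi>\<^sup>i \<otimes> \<partial>\<^sub>i\<close> does not depend on
  the chart.\<close>

definition smooth_tforms ::
    "nat \<Rightarrow> nat \<Rightarrow> ('a, 'n::{finite,linorder}) chart set \<Rightarrow> ('a, 'n) tform set" where
  "smooth_tforms p q A = {\<phi>. \<forall>c\<in>A.
     (\<forall>i K. smooth_fun (coord c ` fst c) (\<lambda>z. \<phi> c z $ i $ K)) \<and>
     (\<forall>z\<in>coord c ` fst c. \<forall>i. of_bidegree p q (\<phi> c z $ i)) \<and>
     (\<forall>c'\<in>A. \<forall>z\<in>coord c ` (fst c \<inter> fst c'). \<forall>i.
        pullback (jacobian (transition c c') z) (\<phi> c' (transition c c' z) $ i) =
          (\<Sum>j\<in>UNIV. jacobian (transition c c') z $ i $ j *s (\<phi> c z $ j)))}"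

definition dcoeff :: "'n \<Rightarrow> (complex^'n \<Rightarrow> 'n::finite ext) \<Rightarrow> complex^'n \<Rightarrow> 'n ext" where
  "dcoeff i \<alpha> z = (\<chi> K. wirtinger i (\<lambda>w. \<alpha> w $ K) z)"

definition del :: "('a, 'n::{finite,linorder}) form \<Rightarrow> ('a, 'n) form" where
  "del \<omega> c z = (\<Sum>i\<in>UNIV. wedge (gen (Dz i)) (dcoeff i (\<omega> c) z))"

definition contract_ext :: "'n::{finite,linorder} ext_tuple \<Rightarrow> 'n ext \<Rightarrow> 'n ext" where
  "contract_ext \<phi> \<alpha> = (\<Sum>i\<in>UNIV. wedge (\<phi> $ i) (interior_prod (Dz i) \<alpha>))"

definition contract :: "('a, 'n::{finite,linorder}) tform \<Rightarrow> ('a, 'n) form \<Rightarrow> ('a, 'n) form" where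
  "contract \<phi> \<omega> c z = contract_ext (\<phi> c z) (\<omega> c z)"

definition bracket ::
    "('a, 'n::{finite,linorder}) tform \<Rightarrow> ('a, 'n) tform \<Rightarrow> ('a, 'n) tform" where
  "bracket \<phi> \<psi> c z = (\<chi> j. \<Sum>i\<in>UNIV.
     wedge (\<phi> c z $ i) (dcoeff i (\<lambda>w. \<psi> c w $ j) z) +
     wedge (\<psi> c z $ i) (dcoeff i (\<lambda>w. \<phi> c w $ j) z))"

section \<open>Holomorphic vector bundles\<close>

text \<open>A local trivialization over \<open>W\<close> is given by its fibre coordinate \<open>h\<close>. The vector space
  structure of the fibres is the one transported along \<open>h\<close>; it is well defined since the
  changes of fibre coordinate are linear.\<close>

type_synonym ('a, 'e, 'r) triv = "'a set \<times> ('e \<Rightarrow> complex^'r)"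

definition holomorphic_vector_bundle ::
    "'a topology \<Rightarrow> ('a, 'n::finite) chart set \<Rightarrow> 'e topology \<Rightarrow> ('e \<Rightarrow> 'a) \<Rightarrow>
     ('a, 'e, 'r::finite) triv set \<Rightarrow> bool" where
  "holomorphic_vector_bundle X A E \<pi> T \<longleftrightarrow>
     continuous_map E X \<pi> \<and>
     (\<Union>t\<in>T. fst t) = topspace X \<and>
     (\<forall>(W, h)\<in>T. openin X W \<and>
        homeomorphic_map (subtopology E {e \<in> topspace E. \<pi> e \<in> W})
          (prod_topology (subtopology X W) euclidean) (\<lambda>e. (\<pi> e, h e))) \<and>
     (\<forall>(W, h)\<in>T. \<forall>(W', h')\<in>T. \<exists>G :: 'a \<Rightarrow> complex^'r^'r.
        (\<forall>x\<in>W \<inter> W'. invertible (G x)) \<and>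
        (\<forall>e\<in>topspace E. \<pi> e \<in> W \<inter> W' \<longrightarrow> h' e = G (\<pi> e) *v h e) \<and>
        (\<forall>c\<in>A. \<forall>i j. holomorphic_fun (coord c ` (fst c \<inter> W \<inter> W'))
           (\<lambda>z. G (point c z) $ i $ j)))"

definition smooth_section ::
    "'a topology \<Rightarrow> ('a, 'n::finite) chart set \<Rightarrow> 'e topology \<Rightarrow> ('e \<Rightarrow> 'a) \<Rightarrow>
     ('a, 'e, 'r::finite) triv set \<Rightarrow> ('a \<Rightarrow> 'e) \<Rightarrow> bool" where
  "smooth_section X A E \<pi> T s \<longleftrightarrow>
     (\<forall>x\<in>topspace X. s x \<in> topspace E \<and> \<pi> (s x) = x) \<and>
     (\<forall>c\<in>A. \<forall>(W, h)\<in>T. \<forall>k.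
        smooth_fun (coord c ` (fst c \<inter> W)) (\<lambda>z. h (s (point c z)) $ k))"

text \<open>A bundle-valued form is expressed in a chart and a trivialization: the coefficients are
  the fibre coordinates of vectors in the fibre.\<close>

type_synonym ('a, 'e, 'n, 'r) vform =
  "('a, 'n) chart \<Rightarrow> ('a, 'e, 'r) triv \<Rightarrow> complex^'n \<Rightarrow> complex^'r^('n covec set)"

definition tensor ::
    "('a, 'n::finite) form \<Rightarrow> ('a \<Rightarrow> 'e) \<Rightarrow> ('a, 'e, 'n, 'r::finite) vform" where
  "tensor \<omega> s c t z = (\<chi> K. (\<omega> c z $ K) *s snd t (s (point c z)))"

text \<open>Writing a bundle-valued form as a sum of \<open>\<eta>\<^sup>k \<otimes> e\<^sub>k\<close> in the local frame of the
  trivialization, contraction acts on the scalar forms \<open>\<eta>\<^sup>k\<close>.\<close>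

definition contract_v ::
    "('a, 'n::{finite,linorder}) tform \<Rightarrow> ('a, 'e, 'n, 'r::finite) vform \<Rightarrow>
     ('a, 'e, 'n, 'r) vform" where
  "contract_v \<phi> \<eta> c t z =
     (\<chi> K k. contract_ext (\<phi> c z) (\<chi> L. \<eta> c t z $ L $ k) $ K)"

end

theory Submission
  imports Defs
begin

text \<open>The identity is local. In a chart write \<open>\<partial> = \<Sum>\<^sub>k dz\<^sup>k \<and> \<partial>\<^sub>k\<close> with \<open>\<partial>\<^sub>k\<close> acting on coefficients, and let
  \<open>C\<^sub>a\<close> be contraction with a tuple \<open>a\<close> of \<open>(0,1)\<close>-covectors. Three facts carry the proof.

  First, \<open>C\<^sub>a\<close> is a derivation of the exterior algebra with \<open>C\<^sub>a dz\<^sup>k = a\<^sup>k\<close> that kills all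
  \<open>(0,1)\<close>-covectors; in terms of multiplication operators, \<open>dz\<^sup>k \<and> C\<^sub>a \<eta> = C\<^sub>a (dz\<^sup>k \<and> \<eta>) - a\<^sup>k \<and> \<eta>\<close>
  (\<open>gen_Dz_wedge_contract_ext\<close>), and \<open>C\<^sub>a\<close> commutes with multiplication by \<open>(0,1)\<close>-covectors
  (\<open>contract_ext_wedge_0_1\<close>). Both follow from the anticommutation relations between exterior
  multiplication and interior product. Second, \<open>\<partial>\<^sub>k\<close> obeys the Leibniz rule for contraction
  (\<open>dcoeff_contract_ext\<close>). Third, multiplication by \<open>dz\<^sup>k\<close> kills \<open>\<omega>\<close> and \<open>\<partial>\<^sub>k \<omega>\<close>, as both have top
  holomorphic degree.

  Writing \<open>a\<close>, \<open>b\<close> for the tuples of \<open>\<phi>1\<close>, \<open>\<phi>2\<close> and omitting \<open>\<and>\<close>, these facts give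
  \<open>C\<^sub>a \<partial> C\<^sub>b \<omega> = - \<Sum>\<^sub>k ((\<partial>\<^sub>k b\<^sup>k) C\<^sub>a \<omega> + b\<^sup>k C\<^sub>a \<partial>\<^sub>k \<omega>)\<close>, the same with \<open>a\<close> and \<open>b\<close> exchanged, and for
  \<open>\<partial> C\<^sub>b C\<^sub>a \<omega>\<close> the sum of these two expressions and of
  \<open>- \<Sum>\<^sub>k (a\<^sup>k C\<^bsub>\<partial>k b\<^esub> \<omega> + b\<^sup>k C\<^bsub>\<partial>k a\<^esub> \<omega>)\<close>. The latter is minus the contraction with the bracket
  (\<open>contract_bracket\<close>), which is the scalar identity. The bundle-valued one
  follows by multiplying with the fibre coordinates of \<open>s\<close>.\<close>

section \<open>The exterior algebra\<close>

definition inversions :: "'a::linorder set \<Rightarrow> 'a set \<Rightarrow> nat" where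
  "inversions I J = card {(a, b). a \<in> I \<and> b \<in> J \<and> b < a}"

lemma inversions_Un_left:
  assumes "finite I" "finite J" "finite L" "I \<inter> J = {}"
  shows "inversions (I \<union> J) L = inversions I L + inversions J L"
proof -
  have "{(a, b). a \<in> I \<union> J \<and> b \<in> L \<and> b < a} =
      {(a, b). a \<in> I \<and> b \<in> L \<and> b < a} \<union> {(a, b). a \<in> J \<and> b \<in> L \<and> b < a}"
    by auto
  moreover have "finite {(a, b). a \<in> P \<and> b \<in> L \<and> b < a}" if "finite P" for P
    by (rule finite_subset[of _ "P \<times> L"]) (use that assms in auto)
  ultimately show ?thesis
    unfolding inversions_def using assms by (subst card_Un_disjoint[symmetric]) auto
qed

lemma inversions_Un_right:
  assumes "finite I" "finite J" "finite L" "J \<inter> L = {}"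
  shows "inversions I (J \<union> L) = inversions I J + inversions I L"
proof -
  have "{(a, b). a \<in> I \<and> b \<in> J \<union> L \<and> b < a} =
      {(a, b). a \<in> I \<and> b \<in> J \<and> b < a} \<union> {(a, b). a \<in> I \<and> b \<in> L \<and> b < a}"
    by auto
  moreover have "finite {(a, b). a \<in> I \<and> b \<in> P \<and> b < a}" if "finite P" for P
    by (rule finite_subset[of _ "I \<times> P"]) (use that assms in auto)
  ultimately show ?thesis
    unfolding inversions_def using assms by (subst card_Un_disjoint[symmetric]) auto
qed

lemma wedge_nth:
  "wedge \<alpha> \<beta> $ K = (\<Sum>I\<in>Pow K. (-1) ^ inversions I (K - I) * \<alpha> $ I * \<beta> $ (K - I))"
  by (simp add: wedge_def inversions_def)

lemma wedge_add_left: "wedge (\<alpha> + \<alpha>') \<beta> = wedge \<alpha> \<beta> + wedge \<alpha>' \<beta>"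
  by (simp add: vec_eq_iff wedge_nth algebra_simps sum.distrib)

lemma wedge_add_right: "wedge \<alpha> (\<beta> + \<beta>') = wedge \<alpha> \<beta> + wedge \<alpha> \<beta>'"
  by (simp add: vec_eq_iff wedge_nth algebra_simps sum.distrib)

lemma wedge_smult_left: "wedge (c *s \<alpha>) \<beta> = c *s wedge \<alpha> \<beta>"
  by (simp add: vec_eq_iff wedge_nth sum_distrib_left mult_ac)

lemma wedge_smult_right: "wedge \<alpha> (c *s \<beta>) = c *s wedge \<alpha> \<beta>"
  by (simp add: vec_eq_iff wedge_nth sum_distrib_left mult_ac)

lemma wedge_zero_left [simp]: "wedge 0 \<beta> = 0"
  by (simp add: vec_eq_iff wedge_nth)

lemma wedge_zero_right [simp]: "wedge \<alpha> 0 = 0"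
  by (simp add: vec_eq_iff wedge_nth)

lemma wedge_minus_left: "wedge (- \<alpha>) \<beta> = - wedge \<alpha> \<beta>"
  by (simp add: vec_eq_iff wedge_nth sum_negf)

lemma wedge_minus_right: "wedge \<alpha> (- \<beta>) = - wedge \<alpha> \<beta>"
  by (simp add: vec_eq_iff wedge_nth sum_negf)

lemma wedge_diff_right: "wedge \<alpha> (\<beta> - \<beta>') = wedge \<alpha> \<beta> - wedge \<alpha> \<beta>'"
  using wedge_add_right[of \<alpha> \<beta> "- \<beta>'"] by (simp add: wedge_minus_right)

lemma wedge_sum_left: "wedge (\<Sum>i\<in>S. f i) \<beta> = (\<Sum>i\<in>S. wedge (f i) \<beta>)"
  by (induction S rule: infinite_finite_induct) (simp_all add: wedge_add_left)

lemma wedge_sum_right: "wedge \<alpha> (\<Sum>i\<in>S. f i) = (\<Sum>i\<in>S. wedge \<alpha> (f i))"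
  by (induction S rule: infinite_finite_induct) (simp_all add: wedge_add_right)

text \<open>Both sides are sums over splittings of \<open>K\<close> into three parts. The signs agree since
  the number of inversions is additive in each argument, so that both count the inversions
  between all pairs of parts.\<close>

lemma wedge_assoc: "wedge (wedge \<alpha> \<beta>) \<gamma> = wedge \<alpha> (wedge \<beta> \<gamma>)"
proof (rule vec_eq_iff[THEN iffD2], rule allI)
  fix K :: "'a covec set"
  let ?s = "\<lambda>I J. (-1) ^ inversions I J :: complex"
  have "wedge (wedge \<alpha> \<beta>) \<gamma> $ K =
      (\<Sum>(J, I)\<in>Sigma (Pow K) Pow.
        ?s J (K - J) * (?s I (J - I) * \<alpha> $ I * \<beta> $ (J - I)) * \<gamma> $ (K - J))"
    by (simp add: wedge_nth sum_distrib_left sum_distrib_right sum.Sigma mult_ac)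
  also have "\<dots> = (\<Sum>(I, L)\<in>(SIGMA I:Pow K. Pow (K - I)).
        ?s I (K - I) * \<alpha> $ I * (?s L (K - I - L) * \<beta> $ L * \<gamma> $ (K - I - L)))"
  proof -
    have "?s I (K - I) * \<alpha> $ I * (?s (J - I) (K - I - (J - I)) * \<beta> $ (J - I) * \<gamma> $ (K - I - (J - I)))
        = ?s J (K - J) * (?s I (J - I) * \<alpha> $ I * \<beta> $ (J - I)) * \<gamma> $ (K - J)"
      if "J \<subseteq> K" "I \<subseteq> J" for I J
    proof -
      have sets: "K - I - (J - I) = K - J" "I \<union> (J - I) = J" "(J - I) \<union> (K - J) = K - I"
        using that by auto
      have "inversions J (K - J) = inversions I (K - J) + inversions (J - I) (K - J)"
        using inversions_Un_left[of I "J - I" "K - J"] unfolding sets by auto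
      moreover have "inversions I (K - I) = inversions I (J - I) + inversions I (K - J)"
        using inversions_Un_right[of I "J - I" "K - J"] that unfolding sets by auto
      ultimately show ?thesis by (simp add: sets(1) power_add)
    qed
    then show ?thesis
      by (intro sum.reindex_bij_witness[where i = "\<lambda>(I, L). (I \<union> L, I)" and j = "\<lambda>(J, I). (I, J - I)"])
        auto
  qed
  also have "\<dots> = wedge \<alpha> (wedge \<beta> \<gamma>) $ K"
    by (simp add: wedge_nth sum_distrib_left sum.Sigma)
  finally show "wedge (wedge \<alpha> \<beta>) \<gamma> $ K = wedge \<alpha> (wedge \<beta> \<gamma>) $ K" .
qed

definition below :: "'a::linorder \<Rightarrow> 'a set \<Rightarrow> nat" where
  "below a K = card {b\<in>K. b < a}"

lemma below_insert:
  assumes "finite K" "b \<notin> K"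
  shows "below a (insert b K) = below a K + (if b < a then 1 else 0)"
proof (cases "b < a")
  case True
  then have "{x \<in> insert b K. x < a} = insert b {x\<in>K. x < a}" by auto
  then show ?thesis using assms True by (simp add: below_def)
next
  case False
  then have "{x \<in> insert b K. x < a} = {x\<in>K. x < a}" by auto
  then show ?thesis using False by (simp add: below_def)
qed

lemma below_insert_self: "below a (insert a K) = below a K"
  unfolding below_def by (rule arg_cong[where f = card]) auto

lemma gen_nth: "gen a $ K = (if K = {a} then 1 else 0)"
  by (simp add: gen_def axis_def)

lemma wedge_gen_nth:
  "wedge (gen a) \<beta> $ K = (if a \<in> K then (-1) ^ below a K * \<beta> $ (K - {a}) else 0)"
proof -
  have "{(x, b). x \<in> {a} \<and> b \<in> K - {a} \<and> b < x} = Pair a ` {b\<in>K. b < a}" by auto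
  then have "inversions {a} (K - {a}) = below a K"
    unfolding inversions_def below_def by (simp add: card_image inj_on_def)
  moreover have "wedge (gen a) \<beta> $ K =
      (\<Sum>I\<in>Pow K. if I = {a} then (-1) ^ inversions I (K - I) * \<beta> $ (K - I) else 0)"
    unfolding wedge_nth by (intro sum.cong) (auto simp: gen_def axis_def)
  ultimately show ?thesis by auto
qed

lemma interior_prod_nth:
  "interior_prod a \<alpha> $ K = (if a \<in> K then 0 else (-1) ^ below a K * \<alpha> $ insert a K)"
  by (simp add: interior_prod_def below_def)

lemma interior_prod_add: "interior_prod a (\<alpha> + \<beta>) = interior_prod a \<alpha> + interior_prod a \<beta>"
  by (simp add: vec_eq_iff interior_prod_nth distrib_left)

lemma interior_prod_smult: "interior_prod a (c *s \<alpha>) = c *s interior_prod a \<alpha>"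
  by (simp add: vec_eq_iff interior_prod_nth)

lemma interior_prod_zero [simp]: "interior_prod a 0 = 0"
  by (simp add: vec_eq_iff interior_prod_nth)

lemma interior_prod_minus: "interior_prod a (- \<alpha>) = - interior_prod a \<alpha>"
  by (simp add: vec_eq_iff interior_prod_nth)

lemma interior_prod_diff: "interior_prod a (\<alpha> - \<beta>) = interior_prod a \<alpha> - interior_prod a \<beta>"
  by (simp add: vec_eq_iff interior_prod_nth right_diff_distrib)

lemma interior_prod_sum: "interior_prod a (\<Sum>i\<in>S. f i) = (\<Sum>i\<in>S. interior_prod a (f i))"
  by (induction S rule: infinite_finite_induct) (simp_all add: interior_prod_add)

lemma gen_wedge_gen: "wedge (gen a) (gen b) = - wedge (gen b) (gen a)"
proof -
  have swap: "wedge (gen u) (gen v) $ {u, v} = - (wedge (gen v) (gen u) $ {u, v})"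
    if "u < v" for u v :: "'a covec"
  proof -
    have "{u, v} - {u} = {v}" "{u, v} - {v} = {u}" "v \<noteq> u" "\<not> v < u" using that by auto
    moreover have "below u {u, v} = below u {v}" "below v {u, v} = below v {v} + 1"
      using that below_insert[of "{v}" u] by auto
    moreover have "below u {v} = 0" "below v {v} = 0"
      using that by (auto simp: below_def)
    ultimately show ?thesis by (simp add: wedge_gen_nth gen_nth)
  qed
  have "wedge (gen a) (gen b) $ K = - (wedge (gen b) (gen a) $ K)" for K
  proof (cases "a \<noteq> b \<and> K = {a, b}")
    case True
    then have "a < b \<or> b < a" by auto
    then show ?thesis using swap[of a b] swap[of b a] True by (auto simp: insert_commute)
  next
    case False
    then have "a \<in> K \<Longrightarrow> K - {a} \<noteq> {b}" "b \<in> K \<Longrightarrow> K - {b} \<noteq> {a}" by auto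
    then show ?thesis by (simp add: wedge_gen_nth gen_nth)
  qed
  then show ?thesis by (simp add: vec_eq_iff)
qed

text \<open>The canonical anticommutation relation. If \<open>a \<noteq> b\<close>, removing \<open>b\<close> from and inserting \<open>a\<close>
  into an index set in either order gives the same set, and the two signs differ because exactly
  one of \<open>a < b\<close> and \<open>b < a\<close> shifts the position of the other element. If \<open>a = b\<close>, exactly one of
  the two orders contributes at each index set, and its sign is a square.\<close>

lemma interior_prod_wedge_gen:
  "interior_prod a (wedge (gen b) \<beta>) =
     (if a = b then \<beta> else 0) - wedge (gen b) (interior_prod a \<beta>)"
proof -
  have "interior_prod a (wedge (gen b) \<beta>) $ K =
     (if a = b then \<beta> $ K else 0) - wedge (gen b) (interior_prod a \<beta>) $ K" for K
  proof (cases "a = b")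
    case True
    show ?thesis
    proof (cases "a \<in> K")
      case a: True
      then obtain L where L: "K = insert a L" "a \<notin> L" by (meson mk_disjoint_insert)
      then have "insert a L - {a} = L" by auto
      with L True show ?thesis
        by (simp add: interior_prod_nth wedge_gen_nth below_insert_self flip: power_add mult_2)
    next
      case False
      with True show ?thesis
        by (simp add: interior_prod_nth wedge_gen_nth below_insert_self flip: power_add mult_2)
    qed
  next
    case ne: False
    show ?thesis
    proof (cases "a \<notin> K \<and> b \<in> K")
      case True
      then obtain L where L: "K = insert b L" "b \<notin> L" by (meson mk_disjoint_insert)
      then have a: "a \<notin> L" and sets: "K - {b} = L" "insert a K - {b} = insert a L"
        using True ne by auto
      have "below a K = below a L + (if b < a then 1 else 0)"
        unfolding L by (rule below_insert) (use L in auto)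
      moreover have "below b (insert a K) = below b K + (if a < b then 1 else 0)"
        by (rule below_insert) (use True in auto)
      moreover have "a < b \<longleftrightarrow> \<not> b < a" using ne by auto
      ultimately show ?thesis
        using True ne by (simp add: interior_prod_nth wedge_gen_nth sets a)
    qed (use ne in \<open>auto simp: interior_prod_nth wedge_gen_nth\<close>)
  qed
  then show ?thesis by (simp add: vec_eq_iff)
qed

section \<open>Contraction with vector-valued \<open>(0,1)\<close>-covectors\<close>

lemma of_bidegree_0_1E:
  fixes \<alpha> :: "'n::{finite,linorder} ext"
  assumes "of_bidegree 0 1 \<alpha>"
  obtains c where "\<alpha> = (\<Sum>j\<in>UNIV. c j *s gen (Dzb j))"
proof -
  have "\<alpha> $ K = (\<Sum>j\<in>UNIV. \<alpha> $ {Dzb j} * gen (Dzb j) $ K)" for K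
  proof (cases "\<exists>j. K = {Dzb j}")
    case True
    then obtain j where "K = {Dzb j}" by auto
    then have "(\<Sum>i\<in>UNIV. \<alpha> $ {Dzb i} * gen (Dzb i) $ K) = (\<Sum>i\<in>UNIV. if i = j then \<alpha> $ K else 0)"
      by (intro sum.cong) (auto simp: gen_def axis_def)
    then show ?thesis by simp
  next
    case False
    have "\<alpha> $ K = 0"
    proof (rule ccontr)
      assume "\<alpha> $ K \<noteq> 0"
      then have c: "card {i. Dz i \<in> K} = 0" "card {i. Dzb i \<in> K} = 1"
        using assms unfolding of_bidegree_def by auto
      then obtain j where "{i. Dzb i \<in> K} = {j}" by (auto simp: card_1_singleton_iff)
      then have "x \<in> K \<longleftrightarrow> x = Dzb j" for x using c by (cases x) auto
      then show False using False by blast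
    qed
    then show ?thesis using False by (auto simp: gen_def axis_def)
  qed
  then have "\<alpha> = (\<Sum>j\<in>UNIV. \<alpha> $ {Dzb j} *s gen (Dzb j))"
    unfolding vec_eq_iff sum_component vector_smult_component by blast
  then show ?thesis by (rule that)
qed

lemma gen_Dz_wedge_0_1:
  assumes "of_bidegree 0 1 \<alpha>"
  shows "wedge (gen (Dz k)) (wedge \<alpha> \<beta>) = - wedge \<alpha> (wedge (gen (Dz k)) \<beta>)"
proof -
  obtain c where "\<alpha> = (\<Sum>j\<in>UNIV. c j *s gen (Dzb j))"
    using assms by (rule of_bidegree_0_1E)
  then have "wedge (gen (Dz k)) \<alpha> = - wedge \<alpha> (gen (Dz k))"
    by (simp add: wedge_sum_left wedge_sum_right wedge_smult_left wedge_smult_right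
        gen_wedge_gen[of "Dz k"] sum_negf vector_smult_rneg)
  then show ?thesis using wedge_minus_left[of "wedge \<alpha> (gen (Dz k))" \<beta>] by (simp flip: wedge_assoc)
qed

lemma wedge_anticommute_0_1:
  assumes "of_bidegree 0 1 \<alpha>" "of_bidegree 0 1 \<beta>"
  shows "wedge \<alpha> (wedge \<beta> \<gamma>) = - wedge \<beta> (wedge \<alpha> \<gamma>)"
proof -
  obtain c where c: "\<alpha> = (\<Sum>j\<in>UNIV. c j *s gen (Dzb j))"
    using assms(1) by (rule of_bidegree_0_1E)
  obtain d where d: "\<beta> = (\<Sum>j\<in>UNIV. d j *s gen (Dzb j))"
    using assms(2) by (rule of_bidegree_0_1E)
  have "wedge (gen (Dzb j)) \<beta> = - wedge \<beta> (gen (Dzb j))" for j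
    unfolding d by (simp add: wedge_sum_left wedge_sum_right wedge_smult_left wedge_smult_right
        gen_wedge_gen[of "Dzb j"] sum_negf vector_smult_rneg)
  then have "wedge \<alpha> \<beta> = - wedge \<beta> \<alpha>"
    unfolding c by (simp add: wedge_sum_left wedge_sum_right wedge_smult_left wedge_smult_right
        sum_negf vector_smult_rneg)
  then show ?thesis using wedge_minus_left[of "wedge \<beta> \<alpha>" \<gamma>] by (simp flip: wedge_assoc)
qed

lemma interior_prod_wedge_0_1:
  assumes "of_bidegree 0 1 \<alpha>"
  shows "interior_prod (Dz i) (wedge \<alpha> \<beta>) = - wedge \<alpha> (interior_prod (Dz i) \<beta>)"
proof -
  obtain c where "\<alpha> = (\<Sum>j\<in>UNIV. c j *s gen (Dzb j))"
    using assms by (rule of_bidegree_0_1E)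
  then show ?thesis
    by (simp add: wedge_sum_left interior_prod_sum wedge_smult_left interior_prod_smult
        interior_prod_wedge_gen sum_negf vector_smult_rneg)
qed

text \<open>A coefficient of \<open>\<eta>\<close> can only be nonzero at an index set that contains every \<open>dz\<^sup>i\<close>.\<close>

lemma gen_Dz_wedge_top:
  fixes \<eta> :: "'n::{finite,linorder} ext"
  assumes "of_bidegree CARD('n) q \<eta>"
  shows "wedge (gen (Dz k)) \<eta> = 0"
proof -
  have "\<eta> $ (K - {Dz k}) = 0" for K
  proof (rule ccontr)
    assume "\<eta> $ (K - {Dz k}) \<noteq> 0"
    then have "card {i. Dz i \<in> K - {Dz k}} = CARD('n)"
      using assms unfolding of_bidegree_def by blast
    then have "{i. Dz i \<in> K - {Dz k}} = UNIV" by (intro card_subset_eq) auto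
    then show False by blast
  qed
  then show ?thesis by (simp add: vec_eq_iff wedge_gen_nth)
qed

lemma contract_ext_zero [simp]: "contract_ext a 0 = 0"
  by (simp add: contract_ext_def)

lemma contract_ext_minus: "contract_ext a (- \<eta>) = - contract_ext a \<eta>"
  by (simp add: contract_ext_def interior_prod_minus wedge_minus_right sum_negf)

lemma contract_ext_add: "contract_ext a (\<eta> + \<xi>) = contract_ext a \<eta> + contract_ext a \<xi>"
  by (simp add: contract_ext_def interior_prod_add wedge_add_right sum.distrib)

lemma contract_ext_diff: "contract_ext a (\<eta> - \<xi>) = contract_ext a \<eta> - contract_ext a \<xi>"
  by (simp add: contract_ext_def interior_prod_diff wedge_diff_right sum_subtractf)

lemma contract_ext_sum: "contract_ext a (\<Sum>i\<in>S. f i) = (\<Sum>i\<in>S. contract_ext a (f i))"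
  by (induction S rule: infinite_finite_induct) (simp_all add: contract_ext_add)

lemma contract_ext_smult: "contract_ext a (c *s \<eta>) = c *s contract_ext a \<eta>"
  by (simp add: contract_ext_def interior_prod_smult wedge_smult_right vec_eq_iff sum_distrib_left)

text \<open>Contraction with a vector-valued \<open>(0,1)\<close>-covector is an even derivation sending \<open>dz\<^sup>k\<close> to
  the component \<open>a\<^sup>k\<close>; its commutator with multiplication by \<open>dz\<^sup>k\<close> is therefore multiplication
  by \<open>a\<^sup>k\<close>. In the \<open>i\<close>-th term of the contraction this comes from \<open>dz\<^sup>k\<close> passing \<open>a\<^sup>i\<close> and the interior product,
  which yields two cancelling signs and the anticommutator term at \<open>i = k\<close>.\<close>

lemma gen_Dz_wedge_contract_ext:
  assumes "\<And>i. of_bidegree 0 1 (a $ i)"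
  shows "wedge (gen (Dz k)) (contract_ext a \<eta>) =
    contract_ext a (wedge (gen (Dz k)) \<eta>) - wedge (a $ k) \<eta>"
proof -
  have "wedge (gen (Dz k)) (wedge (a $ i) (interior_prod (Dz i) \<eta>)) =
      wedge (a $ i) (interior_prod (Dz i) (wedge (gen (Dz k)) \<eta>))
      - (if i = k then wedge (a $ k) \<eta> else 0)" for i
    using assms[of i]
    by (simp add: gen_Dz_wedge_0_1 interior_prod_wedge_gen wedge_diff_right wedge_minus_right)
  then show ?thesis
    by (simp add: contract_ext_def wedge_sum_right sum_subtractf)
qed

text \<open>The same derivation annihilates \<open>(0,1)\<close>-covectors, since these contract to zero with
  every \<open>\<partial>\<^sub>i\<close>.\<close>

lemma contract_ext_wedge_0_1:
  assumes "\<And>i. of_bidegree 0 1 (a $ i)" "of_bidegree 0 1 \<beta>"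
  shows "contract_ext a (wedge \<beta> \<eta>) = wedge \<beta> (contract_ext a \<eta>)"
  unfolding contract_ext_def wedge_sum_right
proof (rule sum.cong[OF refl])
  fix i
  show "wedge (a $ i) (interior_prod (Dz i) (wedge \<beta> \<eta>)) =
      wedge \<beta> (wedge (a $ i) (interior_prod (Dz i) \<eta>))"
    using wedge_anticommute_0_1[OF assms(1)[of i] assms(2)] assms(2)
    by (simp add: interior_prod_wedge_0_1 wedge_minus_right)
qed

text \<open>Below, the commutator is applied once and then twice to a covector killed by
  \<open>dz\<^sup>k\<close>. The second result is symmetric in \<open>a\<close> and \<open>b\<close>, which is what makes the
  terms of the final identity match up.\<close>

lemma gen_Dz_wedge_contract_top:
  assumes "\<And>i. of_bidegree 0 1 (a $ i)" "wedge (gen (Dz k)) \<eta> = 0"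
  shows "wedge (gen (Dz k)) (contract_ext a \<eta>) = - wedge (a $ k) \<eta>"
  using assms by (simp add: gen_Dz_wedge_contract_ext)

lemma gen_Dz_wedge_contract_contract_top:
  assumes "\<And>i. of_bidegree 0 1 (a $ i)" "\<And>i. of_bidegree 0 1 (b $ i)"
    and "wedge (gen (Dz k)) \<eta> = 0"
  shows "wedge (gen (Dz k)) (contract_ext b (contract_ext a \<eta>)) =
    - wedge (a $ k) (contract_ext b \<eta>) - wedge (b $ k) (contract_ext a \<eta>)"
  using assms
  by (simp add: gen_Dz_wedge_contract_ext[of b] gen_Dz_wedge_contract_top contract_ext_minus
      contract_ext_wedge_0_1)

section \<open>Coefficientwise Wirtinger derivatives\<close>

lemma scaleR_eq_smult: "r *\<^sub>R (x :: complex^'k) = complex_of_real r *s x"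
  unfolding vec_eq_iff vector_scaleR_component vector_smult_component
  by (simp add: scaleR_conv_of_real)

lemma bounded_linear_interior_prod: "bounded_linear (interior_prod a)"
  unfolding linear_conv_bounded_linear[symmetric]
  by (rule linearI) (simp_all add: interior_prod_add interior_prod_smult scaleR_eq_smult)

lemma bounded_bilinear_wedge: "bounded_bilinear wedge"
  unfolding bilinear_conv_bounded_bilinear[symmetric] bilinear_def
  by (auto intro!: linearI
      simp: wedge_add_left wedge_add_right wedge_smult_left wedge_smult_right scaleR_eq_smult)

lemma differentiable_vec:
  fixes \<alpha> :: "'b::real_normed_vector \<Rightarrow> complex^'k"
  assumes "\<And>K. (\<lambda>w. \<alpha> w $ K) differentiable (at z)"
  shows "\<alpha> differentiable (at z)"
proof -
  have "bounded_linear (\<lambda>c::complex. c *s (axis K 1 :: complex^'k))" for K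
    unfolding linear_conv_bounded_linear[symmetric]
    by (rule linearI) (simp_all add: vec_eq_iff algebra_simps)
  then have "(\<lambda>w. \<alpha> w $ K *s (axis K 1 :: complex^'k)) differentiable (at z)" for K
    using bounded_linear.has_derivative[of "\<lambda>c::complex. c *s (axis K 1 :: complex^'k)" "\<lambda>w. \<alpha> w $ K"]
      assms unfolding differentiable_def by blast
  then have "(\<lambda>w. \<Sum>K\<in>UNIV. \<alpha> w $ K *s (axis K 1 :: complex^'k)) differentiable (at z)"
    by (intro differentiable_sum) auto
  then show ?thesis by (simp add: basis_expansion)
qed

text \<open>Passing from coefficients to the Frechet derivative of the covector-valued function makes
  the rules for bounded linear and bilinear maps applicable.\<close>

lemma dcoeff_eq:
  assumes "(\<alpha> has_derivative D) (at z)"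
  shows "dcoeff i \<alpha> z = (1/2) *s (D (axis i 1) - \<i> *s D (axis i \<i>))"
proof -
  have "((\<lambda>w. \<alpha> w $ K) has_derivative (\<lambda>v. D v $ K)) (at z)" for K
    by (rule bounded_linear.has_derivative[OF bounded_linear_vec_nth assms])
  then have "frechet_derivative (\<lambda>w. \<alpha> w $ K) (at z) = (\<lambda>v. D v $ K)" for K
    by (metis frechet_derivative_at)
  then show ?thesis by (simp add: dcoeff_def wirtinger_def vec_eq_iff)
qed

lemma dcoeff_add:
  assumes "\<alpha> differentiable (at z)" "\<beta> differentiable (at z)"
  shows "dcoeff i (\<lambda>w. \<alpha> w + \<beta> w) z = dcoeff i \<alpha> z + dcoeff i \<beta> z"
proof -
  obtain D E where D: "(\<alpha> has_derivative D) (at z)" and E: "(\<beta> has_derivative E) (at z)"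
    using assms unfolding differentiable_def by blast
  show ?thesis
    unfolding dcoeff_eq[OF has_derivative_add[OF D E]] dcoeff_eq[OF D] dcoeff_eq[OF E]
    by (simp add: vec_eq_iff field_simps)
qed

lemma dcoeff_sum:
  assumes "finite S" "\<And>j. j \<in> S \<Longrightarrow> \<alpha> j differentiable (at z)"
  shows "dcoeff i (\<lambda>w. \<Sum>j\<in>S. \<alpha> j w) z = (\<Sum>j\<in>S. dcoeff i (\<alpha> j) z)"
  using assms
proof (induction S rule: finite_induct)
  case empty
  show ?case using dcoeff_eq[OF has_derivative_const[of 0]] by simp
next
  case (insert j S)
  have "(\<lambda>w. \<Sum>j\<in>S. \<alpha> j w) differentiable (at z)"
    using insert by (intro differentiable_sum) auto
  then show ?case using insert by (simp add: dcoeff_add)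
qed

lemma dcoeff_interior_prod:
  assumes "\<alpha> differentiable (at z)"
  shows "dcoeff i (\<lambda>w. interior_prod a (\<alpha> w)) z = interior_prod a (dcoeff i \<alpha> z)"
proof -
  obtain D where D: "(\<alpha> has_derivative D) (at z)"
    using assms unfolding differentiable_def by blast
  show ?thesis
    unfolding dcoeff_eq[OF bounded_linear.has_derivative[OF bounded_linear_interior_prod D]]
      dcoeff_eq[OF D]
    by (simp only: interior_prod_smult interior_prod_diff)
qed

lemma dcoeff_wedge:
  assumes "\<alpha> differentiable (at z)" "\<beta> differentiable (at z)"
  shows "dcoeff i (\<lambda>w. wedge (\<alpha> w) (\<beta> w)) z =
    wedge (dcoeff i \<alpha> z) (\<beta> z) + wedge (\<alpha> z) (dcoeff i \<beta> z)"
proof -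
  obtain D E where D: "(\<alpha> has_derivative D) (at z)" and E: "(\<beta> has_derivative E) (at z)"
    using assms unfolding differentiable_def by blast
  have left: "wedge (x - y) u = wedge x u - wedge y u" for x y u
    using wedge_add_left[of x "- y" u] by (simp add: wedge_minus_left)
  show ?thesis
    unfolding dcoeff_eq[OF bounded_bilinear.FDERIV[OF bounded_bilinear_wedge D E]]
      dcoeff_eq[OF D] dcoeff_eq[OF E]
    by (simp add: wedge_smult_left wedge_smult_right left wedge_diff_right vec_eq_iff field_simps)
qed

text \<open>Openness matters: a coefficient outside bidegree \<open>(p, q)\<close> vanishes near \<open>z\<close>, hence so
  does its derivative at \<open>z\<close>.\<close>

lemma dcoeff_of_bidegree:
  fixes z :: "complex^'n::finite"
  assumes "open U" "z \<in> U" "\<And>w. w \<in> U \<Longrightarrow> of_bidegree p q (\<alpha> w)"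
  shows "of_bidegree p q (dcoeff i \<alpha> z)"
  unfolding of_bidegree_def
proof (intro allI impI, rule ccontr)
  fix K
  assume nz: "dcoeff i \<alpha> z $ K \<noteq> 0"
    and "\<not> (card {i. Dz i \<in> K} = p \<and> card {i. Dzb i \<in> K} = q)"
  then have "\<alpha> w $ K = 0" if "w \<in> U" for w
    using assms(3)[OF that] unfolding of_bidegree_def by blast
  then have "((\<lambda>w. \<alpha> w $ K) has_derivative (\<lambda>_. 0)) (at z)"
    by (intro has_derivative_transform_within_open[OF has_derivative_const[of 0] assms(1,2)]) auto
  then have "frechet_derivative (\<lambda>w. \<alpha> w $ K) (at z) = (\<lambda>_. 0)"
    by (metis frechet_derivative_at)
  with nz show False by (simp add: dcoeff_def wirtinger_def)
qed

definition dtuple :: "'n \<Rightarrow> (complex^'n \<Rightarrow> 'n::finite ext_tuple) \<Rightarrow> complex^'n \<Rightarrow> 'n ext_tuple" where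
  "dtuple k a z = (\<chi> i. dcoeff k (\<lambda>w. a w $ i) z)"

lemma
  assumes a: "\<And>i. (\<lambda>w. a w $ i) differentiable (at z)" and \<eta>: "\<eta> differentiable (at z)"
  shows differentiable_contract_ext: "(\<lambda>w. contract_ext (a w) (\<eta> w)) differentiable (at z)"
    and dcoeff_contract_ext: "dcoeff k (\<lambda>w. contract_ext (a w) (\<eta> w)) z =
      contract_ext (dtuple k a z) (\<eta> z) + contract_ext (a z) (dcoeff k \<eta> z)"
proof -
  have int: "(\<lambda>w. interior_prod (Dz i) (\<eta> w)) differentiable (at z)" for i
    using bounded_linear.has_derivative[OF bounded_linear_interior_prod] \<eta>
    unfolding differentiable_def by blast
  have w: "(\<lambda>w. wedge (a w $ i) (interior_prod (Dz i) (\<eta> w))) differentiable (at z)" for i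
    using bounded_bilinear.FDERIV[OF bounded_bilinear_wedge] a[of i] int[of i]
    unfolding differentiable_def by blast
  show "(\<lambda>w. contract_ext (a w) (\<eta> w)) differentiable (at z)"
    unfolding contract_ext_def by (intro differentiable_sum) (auto simp: w)
  show "dcoeff k (\<lambda>w. contract_ext (a w) (\<eta> w)) z =
      contract_ext (dtuple k a z) (\<eta> z) + contract_ext (a z) (dcoeff k \<eta> z)"
    using a int w \<eta>
    by (simp add: contract_ext_def dtuple_def dcoeff_sum dcoeff_wedge dcoeff_interior_prod
        sum.distrib)
qed

lemma contract_ext_tuple_add:
  "contract_ext (a + b) \<eta> = contract_ext a \<eta> + contract_ext b \<eta>"
  by (simp add: contract_ext_def wedge_add_left sum.distrib)

lemma contract_ext_wedge_tuple:
  "contract_ext (\<chi> j. \<Sum>k\<in>S. wedge (\<beta> k) (a k $ j)) \<eta> =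
    (\<Sum>k\<in>S. wedge (\<beta> k) (contract_ext (a k) \<eta>))"
proof -
  have "contract_ext (\<chi> j. \<Sum>k\<in>S. wedge (\<beta> k) (a k $ j)) \<eta> =
      (\<Sum>j\<in>UNIV. \<Sum>k\<in>S. wedge (\<beta> k) (wedge (a k $ j) (interior_prod (Dz j) \<eta>)))"
    by (simp add: contract_ext_def wedge_sum_left wedge_assoc)
  also have "\<dots> = (\<Sum>k\<in>S. \<Sum>j\<in>UNIV. wedge (\<beta> k) (wedge (a k $ j) (interior_prod (Dz j) \<eta>)))"
    by (rule sum.swap)
  finally show ?thesis by (simp add: contract_ext_def wedge_sum_right)
qed

text \<open>The \<open>k\<close>-th term of the bracket contracts as the \<open>(0,1)\<close>-form \<open>\<phi>\<^sup>k\<close> times the contraction with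
  the differentiated tuple \<open>\<partial>\<^sub>k \<psi>\<close>, plus the same with \<open>\<phi>\<close> and \<open>\<psi>\<close> exchanged. This brings the left
  side of the identity into the shape in which the right side is computed.\<close>

lemma contract_bracket:
  "contract (bracket \<phi> \<psi>) \<omega> c z =
    (\<Sum>k\<in>UNIV. wedge (\<phi> c z $ k) (contract_ext (dtuple k (\<psi> c) z) (\<omega> c z))
      + wedge (\<psi> c z $ k) (contract_ext (dtuple k (\<phi> c) z) (\<omega> c z)))"
proof -
  have "bracket \<phi> \<psi> c z = (\<chi> j. \<Sum>k\<in>UNIV. wedge (\<phi> c z $ k) (dtuple k (\<psi> c) z $ j))
      + (\<chi> j. \<Sum>k\<in>UNIV. wedge (\<psi> c z $ k) (dtuple k (\<phi> c) z $ j))"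
    by (simp add: bracket_def dtuple_def vec_eq_iff sum.distrib)
  then show ?thesis
    by (simp only: contract_def contract_ext_tuple_add contract_ext_wedge_tuple sum.distrib)
qed

section \<open>The identity in a chart\<close>

lemma smooth_fun_differentiable: "smooth_fun S f \<Longrightarrow> z \<in> S \<Longrightarrow> f differentiable (at z)"
  unfolding smooth_fun_def using diff_order.simps(2)[of 0 S f] by blast

text \<open>The Leibniz rule for \<open>\<partial>\<^sub>k\<close> is combined with the commutators with \<open>dz\<^sup>k\<close>. Both \<open>\<omega>\<close> and
  \<open>\<partial>\<^sub>k \<omega>\<close> have top holomorphic degree, so \<open>dz\<^sup>k\<close> survives only where it meets a contraction. Each of
  the three sums over \<open>k\<close> is expanded into products of the form
  (\<open>(0,1)\<close>-form) \<open>\<and>\<close> (contraction of \<open>\<omega>\<close> or \<open>\<partial>\<^sub>k \<omega>\<close>), and the identity then holds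
  for each \<open>k\<close> separately.\<close>

lemma contract_bracket_del:
  fixes A :: "('a, 'n::{finite,linorder}) chart set"
  assumes "complex_manifold X A"
    and \<phi>1: "\<phi>1 \<in> smooth_tforms 0 1 A"
    and \<phi>2: "\<phi>2 \<in> smooth_tforms 0 1 A"
    and \<omega>: "\<omega> \<in> smooth_forms CARD('n) q A"
    and c: "c \<in> A" and z: "z \<in> coord c ` fst c"
  shows "contract (bracket \<phi>1 \<phi>2) \<omega> c z =
    contract \<phi>1 (del (contract \<phi>2 \<omega>)) c z
    - del (contract \<phi>2 (contract \<phi>1 \<omega>)) c z
    + contract \<phi>2 (del (contract \<phi>1 \<omega>)) c z"
proof -
  define U where "U = coord c ` fst c"
  have U: "open U" "z \<in> U"
    using assms(1) c z unfolding complex_manifold_def U_def by auto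
  have deg: "of_bidegree 0 1 (\<phi> c z $ i)" "of_bidegree 0 1 (dtuple k (\<phi> c) z $ i)"
    and diff: "(\<lambda>w. \<phi> c w $ i) differentiable (at z)"
    if \<phi>: "\<phi> \<in> smooth_tforms 0 1 A" for \<phi> i k
  proof -
    have "of_bidegree 0 1 (\<phi> c w $ i)" if "w \<in> U" for w
      using \<phi> c that unfolding smooth_tforms_def U_def by blast
    then show "of_bidegree 0 1 (\<phi> c z $ i)" "of_bidegree 0 1 (dtuple k (\<phi> c) z $ i)"
      using U by (auto simp: dtuple_def intro!: dcoeff_of_bidegree[of U])
    show "(\<lambda>w. \<phi> c w $ i) differentiable (at z)"
      using \<phi> c U(2) unfolding smooth_tforms_def U_def
      by (intro differentiable_vec smooth_fun_differentiable) auto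
  qed
  have diff_\<omega>: "\<omega> c differentiable (at z)"
    using \<omega> c U(2) unfolding smooth_forms_def U_def
    by (intro differentiable_vec smooth_fun_differentiable) auto
  have deg_\<omega>: "of_bidegree CARD('n) q (\<omega> c w)" if "w \<in> U" for w
    using \<omega> c that unfolding smooth_forms_def U_def by blast
  have top: "wedge (gen (Dz k)) (\<omega> c z) = 0" "wedge (gen (Dz k)) (dcoeff k (\<omega> c) z) = 0" for k
    using U deg_\<omega> by (auto intro: gen_Dz_wedge_top dcoeff_of_bidegree)
  let ?D = "\<lambda>k \<phi>. dtuple k (\<phi> c) z"
  have del1: "del (contract \<phi> \<omega>) c z =
      (\<Sum>k\<in>UNIV. - wedge (?D k \<phi> $ k) (\<omega> c z) - wedge (\<phi> c z $ k) (dcoeff k (\<omega> c) z))"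
    if \<phi>: "\<phi> \<in> smooth_tforms 0 1 A" for \<phi>
    unfolding del_def contract_def[abs_def]
    by (simp add: dcoeff_contract_ext diff[OF \<phi>] diff_\<omega> wedge_add_right
        gen_Dz_wedge_contract_top deg[OF \<phi>, simplified] top)
  have contract_del: "contract \<psi> (del (contract \<phi> \<omega>)) c z =
      (\<Sum>k\<in>UNIV. - wedge (?D k \<phi> $ k) (contract_ext (\<psi> c z) (\<omega> c z))
        - wedge (\<phi> c z $ k) (contract_ext (\<psi> c z) (dcoeff k (\<omega> c) z)))"
    if \<phi>: "\<phi> \<in> smooth_tforms 0 1 A" and \<psi>: "\<psi> \<in> smooth_tforms 0 1 A" for \<phi> \<psi>
    unfolding contract_def[of \<psi>] del1[OF \<phi>]
    by (simp add: contract_ext_sum contract_ext_minus contract_ext_diff contract_ext_wedge_0_1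
        deg[OF \<phi>, simplified] deg[OF \<psi>, simplified])
  have del2: "del (contract \<phi>2 (contract \<phi>1 \<omega>)) c z =
      (\<Sum>k\<in>UNIV.
        - wedge (\<phi>1 c z $ k) (contract_ext (?D k \<phi>2) (\<omega> c z))
        - wedge (?D k \<phi>2 $ k) (contract_ext (\<phi>1 c z) (\<omega> c z))
        - wedge (?D k \<phi>1 $ k) (contract_ext (\<phi>2 c z) (\<omega> c z))
        - wedge (\<phi>2 c z $ k) (contract_ext (?D k \<phi>1) (\<omega> c z))
        - wedge (\<phi>1 c z $ k) (contract_ext (\<phi>2 c z) (dcoeff k (\<omega> c) z))
        - wedge (\<phi>2 c z $ k) (contract_ext (\<phi>1 c z) (dcoeff k (\<omega> c) z)))"
    unfolding del_def contract_def[abs_def]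
    by (simp add: dcoeff_contract_ext differentiable_contract_ext diff[OF \<phi>1] diff[OF \<phi>2] diff_\<omega>
        wedge_add_right contract_ext_add gen_Dz_wedge_contract_contract_top
        deg[OF \<phi>1, simplified] deg[OF \<phi>2, simplified] top
        sum.distrib sum_subtractf sum_negf)
  show ?thesis
    unfolding contract_bracket contract_del[OF \<phi>2 \<phi>1] contract_del[OF \<phi>1 \<phi>2] del2
    by (simp add: sum.distrib sum_subtractf sum_negf)
qed

theorem proposition3p2:
  fixes X :: "'a topology"
    and A :: "('a, 'n::{finite,linorder}) chart set"
    and \<phi>1 \<phi>2 :: "('a, 'n) tform"
    and \<omega> :: "('a, 'n) form"
    and q :: nat
  assumes "complex_manifold X A"
    and "\<phi>1 \<in> smooth_tforms 0 1 A"
    and "\<phi>2 \<in> smooth_tforms 0 1 A"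
    and "\<omega> \<in> smooth_forms CARD('n) q A"
  shows
    "(\<forall>(E :: 'e topology) \<pi> (T :: ('a, 'e, 'r::finite) triv set) s.
        holomorphic_vector_bundle X A E \<pi> T \<and> smooth_section X A E \<pi> T s \<longrightarrow>
        (\<forall>c\<in>A. \<forall>t\<in>T. \<forall>z\<in>coord c ` (fst c \<inter> fst t).
           contract_v (bracket \<phi>1 \<phi>2) (tensor \<omega> s) c t z =
             tensor (contract \<phi>1 (del (contract \<phi>2 \<omega>))) s c t z
             - tensor (del (contract \<phi>2 (contract \<phi>1 \<omega>))) s c t z
             + tensor (contract \<phi>2 (del (contract \<phi>1 \<omega>))) s c t z)) \<and>
     (\<forall>c\<in>A. \<forall>z\<in>coord c ` fst c.
        contract (bracket \<phi>1 \<phi>2) \<omega> c z =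
          contract \<phi>1 (del (contract \<phi>2 \<omega>)) c z
          - del (contract \<phi>2 (contract \<phi>1 \<omega>)) c z
          + contract \<phi>2 (del (contract \<phi>1 \<omega>)) c z)"
proof -
  \<comment> \<open>In a local frame the form attached to the \<open>k\<close>-th frame vector is the coordinate \<open>s\<^sup>k\<close>
    times \<open>\<omega>\<close>, and contraction is linear over functions.\<close>
  have contract_tensor: "contract_v \<phi> (tensor \<omega> s) c t z = tensor (contract \<phi> \<omega>) s c t z"
    for \<phi> and s :: "'a \<Rightarrow> 'e" and c z and t :: "('a, 'e, 'r) triv"
  proof -
    have coeff: "(\<chi> L. tensor \<omega> s c t z $ L $ k) = snd t (s (point c z)) $ k *s \<omega> c z" for k
      by (simp add: tensor_def vec_eq_iff mult.commute)
    show ?thesis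
      unfolding contract_v_def coeff contract_ext_smult
      by (simp add: tensor_def contract_def vec_eq_iff mult.commute)
  qed
  have scalar: "contract (bracket \<phi>1 \<phi>2) \<omega> c z =
      contract \<phi>1 (del (contract \<phi>2 \<omega>)) c z
      - del (contract \<phi>2 (contract \<phi>1 \<omega>)) c z
      + contract \<phi>2 (del (contract \<phi>1 \<omega>)) c z"
    if "c \<in> A" "z \<in> coord c ` fst c" for c z
    using contract_bracket_del[OF assms that] .
  have "contract_v (bracket \<phi>1 \<phi>2) (tensor \<omega> s) c t z =
      tensor (contract \<phi>1 (del (contract \<phi>2 \<omega>))) s c t z
      - tensor (del (contract \<phi>2 (contract \<phi>1 \<omega>))) s c t z
      + tensor (contract \<phi>2 (del (contract \<phi>1 \<omega>))) s c t z"
    if "c \<in> A" "z \<in> coord c ` (fst c \<inter> fst t)"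
    for s :: "'a \<Rightarrow> 'e" and c z and t :: "('a, 'e, 'r) triv"
  proof -
    have z: "z \<in> coord c ` fst c" using that(2) by auto
    show ?thesis
      unfolding contract_tensor tensor_def scalar[OF that(1) z]
      by (simp add: vec_eq_iff algebra_simps)
  qed
  with scalar show ?thesis by blast
qed

end
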